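(* Let $\rho,\kappa>-1$ be real numbers, $m\ge0$ an integer, $n$ an integer with $n+\rho\ge0$, and set $m_\rho=m+\rho$. Then the function $f=\mathcal{Z}^{\kappa,\rho}_{m,n}$ is a solution on $\mathbb{D}^*$ of $$z^2(1-|z|^2)\frac{\partial^2 f}{\partial z^2}+\Big((m_\rho-n+1)-(\kappa+m_\rho-n+2)|z|^2\Big)z\frac{\partial f}{\partial z}+n(\kappa+m_\rho+1)|z|^2 f=\rho(n-m)f.$$
   Context: Let $\mathbb{D}=\{z\in\mathbb{C}:|z|<1\}$ and $\mathbb{D}^*=\mathbb{D}\setminus\{0\}$; $\partial/\partial z$ is the Wirtinger derivative. For reals $\rho,\kappa>-1$ and integers $m\ge0$, $n$ with $n+\rho\ge0$, the fractional Zernike function on $\mathbb{D}^*$ is $$\mathcal{Z}^{\kappa,\rho}_{m,n}(z,\bar z)=(-1)^m z^{-\rho}(1-|z|^2)^{-\kappa}\frac{\partial^m}{\partial z^m}\Big(z^{n+\rho}(1-|z|^2)^{\kappa+m}\Big),$$ the powers $z^{-\rho}$ and $z^{n+\rho}$ being taken with the same local branch (the result does not depend on the choice). *)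

theory Defs
  imports "HOL-Complex_Analysis.Complex_Analysis"
begin

definition punctured_disc :: "complex set" where
  "punctured_disc = ball 0 1 - {0}"

text \<open>
  The Wirtinger derivative \<open>\<partial>/\<partial>z = (\<partial>/\<partial>x - \<i> \<partial>/\<partial>y) / 2\<close>.  Like \<^const>\<open>vector_derivative\<close>, it is
  total; it is only meaningful at points where \<open>f\<close> has partial derivatives.
\<close>
definition wirtinger :: "(complex \<Rightarrow> complex) \<Rightarrow> complex \<Rightarrow> complex" where
  "wirtinger f z =
     (vector_derivative (\<lambda>t::real. f (z + of_real t)) (at 0)
      - \<i> * vector_derivative (\<lambda>t::real. f (z + \<i> * of_real t)) (at 0)) / 2"

definition log_branch :: "complex set \<Rightarrow> (complex \<Rightarrow> complex) \<Rightarrow> bool" where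
  "log_branch U L \<longleftrightarrow> open U \<and> L holomorphic_on U \<and> (\<forall>w\<in>U. exp (L w) = w)"

text \<open>
  The fractional Zernike function at \<open>z\<close>, both complex powers being computed from the
  logarithm \<open>L\<close>.  Only the values of \<open>L\<close> near \<open>z\<close> matter.
\<close>
definition zernike_branch ::
    "(complex \<Rightarrow> complex) \<Rightarrow> real \<Rightarrow> real \<Rightarrow> nat \<Rightarrow> int \<Rightarrow> complex \<Rightarrow> complex" where
  "zernike_branch L \<kappa> \<rho> m n z =
     (-1) ^ m * exp (- of_real \<rho> * L z) * of_real ((1 - (cmod z)\<^sup>2) powr (-\<kappa>)) *
     (wirtinger ^^ m)
       (\<lambda>w. exp (of_real (of_int n + \<rho>) * L w) * of_real ((1 - (cmod w)\<^sup>2) powr (\<kappa> + real m))) z"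

text \<open>
  The branch used at \<open>z\<close> is \<open>w \<mapsto> Ln z + Ln (w / z)\<close>, which is holomorphic on the half plane
  \<open>{w. Re (w / z) > 0}\<close> around \<open>z\<close>, also when \<open>z\<close> lies on the cut of \<^const>\<open>Ln\<close>.  Any other
  local branch at \<open>z\<close> gives the same value: see \<open>zernike_eq_zernike_branch\<close> below.
\<close>
definition zernike :: "real \<Rightarrow> real \<Rightarrow> nat \<Rightarrow> int \<Rightarrow> complex \<Rightarrow> complex" where
  "zernike \<kappa> \<rho> m n z = zernike_branch (\<lambda>w. Ln z + Ln (w / z)) \<kappa> \<rho> m n z"


subsection \<open>Independence of the branch\<close>

lemma log_branch_local:
  assumes "z \<noteq> 0"
  shows "log_branch {w. Re (w / z) > 0} (\<lambda>w. Ln z + Ln (w / z))"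
proof -
  have "open {w. Re (w / z) > 0}"
    using assms by (intro open_Collect_less continuous_intros) auto
  moreover have "(\<lambda>w. Ln z + Ln (w / z)) holomorphic_on {w. Re (w / z) > 0}"
    using assms by (intro holomorphic_intros) (auto simp: complex_nonpos_Reals_iff)
  moreover have "exp (Ln z + Ln (w / z)) = w" if "Re (w / z) > 0" for w
  proof -
    have "w / z \<noteq> 0" using that by (metis less_irrefl zero_complex.sel(1))
    then show ?thesis using assms by (simp add: exp_add)
  qed
  ultimately show ?thesis
    by (auto simp: log_branch_def)
qed

lemma log_branch_deriv:
  assumes "log_branch U L" "w \<in> U"
  shows "(L has_field_derivative inverse w) (at w)"
proof -
  have U: "open U" and e: "\<And>v. v \<in> U \<Longrightarrow> exp (L v) = v" and h: "L holomorphic_on U"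
    using assms by (auto simp: log_branch_def)
  have d: "(L has_field_derivative deriv L w) (at w)"
    using h U assms(2) by (rule holomorphic_derivI)
  have "((\<lambda>v. exp (L v)) has_field_derivative exp (L w) * deriv L w) (at w)"
    by (rule DERIV_fun_exp[OF d])
  then have "((\<lambda>v. v) has_field_derivative w * deriv L w) (at w)"
    unfolding e[OF assms(2)]
    by (rule has_field_derivative_transform_within_open[OF _ U assms(2)]) (rule e)
  then have "w * deriv L w = 1"
    using DERIV_ident DERIV_unique by blast
  then have "deriv L w = inverse w"
    by (metis inverse_unique)
  then show ?thesis using d by simp
qed

lemma wirtinger_eqI:
  assumes "(f has_derivative (\<lambda>h. a * h + b * cnj h)) (at z)"
  shows "wirtinger f z = a"
proof -
  have 1: "((\<lambda>t::real. f (z + of_real t)) has_vector_derivative (a + b)) (at 0)"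
  proof -
    have "((\<lambda>t::real. z + of_real t) has_derivative (\<lambda>t. of_real t)) (at 0)"
      by (auto intro!: derivative_eq_intros)
    from diff_chain_at[OF this, of f "\<lambda>h. a * h + b * cnj h"] assms
    show ?thesis
      by (simp add: has_vector_derivative_def o_def scaleR_conv_of_real algebra_simps)
  qed
  have 2: "((\<lambda>t::real. f (z + \<i> * of_real t)) has_vector_derivative (\<i> * (a - b))) (at 0)"
  proof -
    have "((\<lambda>t::real. z + \<i> * of_real t) has_derivative (\<lambda>t. \<i> * of_real t)) (at 0)"
      by (auto intro!: derivative_eq_intros)
    from diff_chain_at[OF this, of f "\<lambda>h. a * h + b * cnj h"] assms
    show ?thesis
      by (simp add: has_vector_derivative_def o_def scaleR_conv_of_real algebra_simps)
  qed
  show ?thesis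
    unfolding wirtinger_def vector_derivative_at[OF 1] vector_derivative_at[OF 2]
    by (simp add: algebra_simps)
qed

inductive_set power_span :: "(complex \<Rightarrow> complex) \<Rightarrow> (complex \<Rightarrow> complex) set"
  for L :: "complex \<Rightarrow> complex" where
  power_span_monom:
    "(\<lambda>w. exp (a * L w) * cnj w ^ p * of_real ((1 - (cmod w)\<^sup>2) powr b)) \<in> power_span L"
| power_span_cmult: "f \<in> power_span L \<Longrightarrow> (\<lambda>w. c * f w) \<in> power_span L"
| power_span_add: "f \<in> power_span L \<Longrightarrow> g \<in> power_span L \<Longrightarrow> (\<lambda>w. f w + g w) \<in> power_span L"

lemma power_span_derivative:
  assumes "f \<in> power_span L" "log_branch U L" "U \<subseteq> ball 0 1"
  shows "\<exists>g\<in>power_span L. \<exists>g'. \<forall>w\<in>U. (f has_derivative (\<lambda>h. g w * h + g' w * cnj h)) (at w)"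
  using assms(1)
proof induction
  case (power_span_monom a p b)
  define M where "M = (\<lambda>a p b w. exp (a * L w) * cnj w ^ p * of_real ((1 - (cmod w)\<^sup>2) powr b))"
  define g' where "g' = (\<lambda>w. exp (a * L w) *
      (of_nat p * cnj w ^ (p - 1) * of_real ((1 - (cmod w)\<^sup>2) powr b)
       - of_real b * w * cnj w ^ p * of_real ((1 - (cmod w)\<^sup>2) powr (b - 1))))"
  have "(M a p b has_derivative (\<lambda>h. (a * M (a - 1) p b w + (- of_real b) * M a (Suc p) (b - 1) w) * h
           + g' w * cnj h)) (at w)" if w: "w \<in> U" for w
  proof -
    have pos: "1 - (cmod w)\<^sup>2 > 0"
      using w assms(3) by (auto simp: power_less_one_iff abs_square_less_1)
    have eL: "exp (L w) = w"
      using w assms(2) by (auto simp: log_branch_def)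
    then have w0: "w \<noteq> 0" by (metis exp_not_eq_zero)
    have D1: "((\<lambda>w. exp (a * L w)) has_derivative (\<lambda>h. a * exp ((a - 1) * L w) * h)) (at w)"
    proof -
      have "((\<lambda>w. exp (a * L w)) has_field_derivative exp (a * L w) * (a * inverse w)) (at w)"
        using log_branch_deriv[OF assms(2) w]
        by (auto intro!: derivative_eq_intros)
      moreover have "exp (a * L w) * (a * inverse w) = a * exp ((a - 1) * L w)"
        using w0 eL by (simp add: left_diff_distrib exp_diff field_simps)
      ultimately show ?thesis
        by (simp add: has_field_derivative_def)
    qed
    have D2: "((\<lambda>w. cnj w ^ p) has_derivative (\<lambda>h. of_nat p * cnj w ^ (p - 1) * cnj h)) (at w)"
      using has_derivative_power[OF bounded_linear_imp_has_derivative[OF bounded_linear_cnj], of p w UNIV]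
      by (simp add: mult_ac)
    have N: "((\<lambda>w. 1 - (cmod w)\<^sup>2) has_derivative (\<lambda>h. - (2 * (w \<bullet> h)))) (at w)"
      unfolding power2_norm_eq_inner
      by (auto intro!: derivative_eq_intros simp: inner_commute)
    have P: "((\<lambda>x::real. x powr b) has_derivative (\<lambda>h. (b * (1 - (cmod w)\<^sup>2) powr (b - 1)) * h))
              (at (1 - (cmod w)\<^sup>2))"
      using has_real_derivative_powr[OF pos, of b]
      by (simp add: has_field_derivative_def)
    have D3: "((\<lambda>w. complex_of_real ((1 - (cmod w)\<^sup>2) powr b)) has_derivative
        (\<lambda>h. of_real ((b * (1 - (cmod w)\<^sup>2) powr (b - 1)) * - (2 * (w \<bullet> h))))) (at w)"
      using has_derivative_of_real[OF diff_chain_at[OF N P]] by (simp add: o_def)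
    have R: "complex_of_real (2 * (w \<bullet> h)) = cnj w * h + w * cnj h" for h
      by (simp add: complex_eq_iff inner_complex_def)
    have R': "complex_of_real ((b * (1 - (cmod w)\<^sup>2) powr (b - 1)) * - (2 * (w \<bullet> h))) =
       - (cnj w * h + w * cnj h) * (of_real b * of_real ((1 - (cmod w)\<^sup>2) powr (b - 1)))" for h
      unfolding R[symmetric] by simp
    show ?thesis
      unfolding M_def g'_def
      by (rule has_derivative_eq_rhs, rule has_derivative_mult[OF has_derivative_mult[OF D1 D2] D3])
         (unfold R', simp add: fun_eq_iff algebra_simps)
  qed
  moreover have "(\<lambda>w. a * M (a - 1) p b w + (- of_real b) * M a (Suc p) (b - 1) w) \<in> power_span L"
    unfolding M_def by (intro power_span.intros)
  ultimately show ?case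
    unfolding M_def by (intro bexI exI ballI) auto
next
  case (power_span_cmult f c)
  then obtain g g' where g: "g \<in> power_span L"
    "\<And>w. w \<in> U \<Longrightarrow> (f has_derivative (\<lambda>h. g w * h + g' w * cnj h)) (at w)" by blast
  have "((\<lambda>w. c * f w) has_derivative (\<lambda>h. c * g w * h + c * g' w * cnj h)) (at w)" if "w \<in> U" for w
    using has_derivative_mult_right[OF g(2)[OF that], of c] by (simp add: algebra_simps)
  then show ?case
    using power_span.power_span_cmult[OF g(1), of c]
    by (intro bexI[of _ "\<lambda>w. c * g w"] exI[of _ "\<lambda>w. c * g' w"]) auto
next
  case (power_span_add f1 f2)
  then obtain g1 g1' g2 g2' where g: "g1 \<in> power_span L" "g2 \<in> power_span L"
    "\<And>w. w \<in> U \<Longrightarrow> (f1 has_derivative (\<lambda>h. g1 w * h + g1' w * cnj h)) (at w)"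
    "\<And>w. w \<in> U \<Longrightarrow> (f2 has_derivative (\<lambda>h. g2 w * h + g2' w * cnj h)) (at w)" by blast
  have "((\<lambda>w. f1 w + f2 w) has_derivative
      (\<lambda>h. (g1 w + g2 w) * h + (g1' w + g2' w) * cnj h)) (at w)" if "w \<in> U" for w
    using has_derivative_add[OF g(3)[OF that] g(4)[OF that]] by (simp add: algebra_simps)
  then show ?case
    using power_span.power_span_add[OF g(1,2)]
    by (intro bexI[of _ "\<lambda>w. g1 w + g2 w"] exI[of _ "\<lambda>w. g1' w + g2' w"]) auto
qed

lemma wirtinger_iterate:
  assumes "f \<in> power_span L" "log_branch U L" "U \<subseteq> ball 0 1" "\<And>w. w \<in> U \<Longrightarrow> F w = c * f w"
  shows "\<exists>g\<in>power_span L. \<forall>w\<in>U. (wirtinger ^^ j) F w = c * g w \<and> (wirtinger ^^ j) f w = g w"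
proof (induction j)
  case 0
  then show ?case using assms by auto
next
  case (Suc j)
  then obtain g where g: "g \<in> power_span L"
    "\<And>w. w \<in> U \<Longrightarrow> (wirtinger ^^ j) F w = c * g w" "\<And>w. w \<in> U \<Longrightarrow> (wirtinger ^^ j) f w = g w"
    by blast
  obtain d d' where d: "d \<in> power_span L"
    "\<And>w. w \<in> U \<Longrightarrow> (g has_derivative (\<lambda>h. d w * h + d' w * cnj h)) (at w)"
    using power_span_derivative[OF g(1) assms(2,3)] by blast
  have U: "open U" using assms(2) by (simp add: log_branch_def)
  have "wirtinger ((wirtinger ^^ j) F) w = c * d w \<and> wirtinger ((wirtinger ^^ j) f) w = d w"
    if w: "w \<in> U" for w
  proof
    have "((\<lambda>w. c * g w) has_derivative (\<lambda>h. c * d w * h + c * d' w * cnj h)) (at w)"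
      using has_derivative_mult_right[OF d(2)[OF w], of c] by (simp add: algebra_simps)
    then show "wirtinger ((wirtinger ^^ j) F) w = c * d w"
      by (rule wirtinger_eqI[OF has_derivative_transform_within_open[OF _ U w]])
         (use g(2) in auto)
    show "wirtinger ((wirtinger ^^ j) f) w = d w"
      by (rule wirtinger_eqI[OF has_derivative_transform_within_open[OF d(2)[OF w] U w]])
         (use g(3) in auto)
  qed
  then show ?case using d(1) by auto
qed

lemma zernike_branch_unique:
  assumes "log_branch U L" "log_branch U' L'" "z \<in> U" "z \<in> U'" "z \<in> ball 0 1"
  shows "zernike_branch L \<kappa> \<rho> m n z = zernike_branch L' \<kappa> \<rho> m n z"
proof -
  have "open (U \<inter> U' \<inter> ball 0 1)"
    using assms by (auto simp: log_branch_def)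
  then obtain r where r: "r > 0" "ball z r \<subseteq> U \<inter> U' \<inter> ball 0 1"
    using assms openE by (metis Int_iff)
  define V where "V = ball z r"
  have V: "open V" "z \<in> V" "V \<subseteq> U" "V \<subseteq> U'" "V \<subseteq> ball 0 1" "convex V"
    using r by (auto simp: V_def)
  have LV: "log_branch V L'"
    using assms(2) V by (auto simp: log_branch_def intro: holomorphic_on_subset)
  have "((\<lambda>w. L w - L' w) has_field_derivative 0) (at w within V)" if "w \<in> V" for w
  proof -
    have "((\<lambda>w. L w - L' w) has_field_derivative inverse w - inverse w) (at w)"
      using that V by (intro derivative_intros log_branch_deriv[OF assms(1)] log_branch_deriv[OF assms(2)]) auto
    then show ?thesis by (simp add: has_field_derivative_at_within)
  qed
  from has_field_derivative_zero_constant[OF V(6) this]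
  obtain d where d: "\<And>w. w \<in> V \<Longrightarrow> L w = L' w + d"
    by (metis diff_add_cancel add.commute)
  have "exp (L z) = z" "exp (L' z) = z"
    using assms by (auto simp: log_branch_def)
  then have ed: "exp d = 1"
    using d[OF V(2)] by (metis exp_add exp_not_eq_zero mult_cancel_left2)
  define f where "f = (\<lambda>L w. exp (complex_of_real (of_int n + \<rho>) * L w) *
      complex_of_real ((1 - (cmod w)\<^sup>2) powr (\<kappa> + real m)))"
  have "f L' \<in> power_span L'"
    using power_span_monom[of "of_real (of_int n + \<rho>)" L' 0 "\<kappa> + real m"] by (simp add: f_def)
  moreover have "f L w = exp (of_real (of_int n + \<rho>) * d) * f L' w" if "w \<in> V" for w
    using d[OF that] by (simp add: f_def exp_add distrib_left)
  ultimately have W: "(wirtinger ^^ m) (f L) z =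
      exp (of_real (of_int n + \<rho>) * d) * (wirtinger ^^ m) (f L') z"
    using wirtinger_iterate[OF _ LV V(5), of "f L'" "f L" _ m] V(2) by fastforce
  have "exp (- of_real \<rho> * d) * exp (of_real (of_int n + \<rho>) * d) = exp (of_int n * d)"
    by (simp add: exp_add[symmetric] algebra_simps)
  also have "\<dots> = exp d powi n"
    by (simp add: exp_power_int mult.commute)
  finally have one: "exp (- of_real \<rho> * d) * exp (of_real (of_int n + \<rho>) * d) = 1"
    by (simp add: ed)
  have E: "exp (- of_real \<rho> * L z) = exp (- of_real \<rho> * d) * exp (- of_real \<rho> * L' z)"
    unfolding d[OF V(2)] exp_add[symmetric] by (simp add: algebra_simps)
  have "exp (- of_real \<rho> * L z) * (wirtinger ^^ m) (f L) z =
      (exp (- of_real \<rho> * d) * exp (of_real (of_int n + \<rho>) * d)) *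
      (exp (- of_real \<rho> * L' z) * (wirtinger ^^ m) (f L') z)"
    unfolding E W by (simp only: mult_ac)
  then have "exp (- of_real \<rho> * L z) * (wirtinger ^^ m) (f L) z =
      exp (- of_real \<rho> * L' z) * (wirtinger ^^ m) (f L') z"
    unfolding one by simp
  then show ?thesis
    unfolding zernike_branch_def f_def by (simp add: mult_ac)
qed

lemma zernike_eq_zernike_branch:
  assumes "z \<in> punctured_disc" "log_branch U L" "z \<in> U"
  shows "zernike \<kappa> \<rho> m n z = zernike_branch L \<kappa> \<rho> m n z"
  unfolding zernike_def
  using assms by (intro zernike_branch_unique[OF log_branch_local]) (auto simp: punctured_disc_def)

end

theory Submission
  imports Defs
begin

text \<open>
  Write \<open>c\<close> for the conjugate of \<open>z\<close>, which \<open>\<partial>/\<partial>z\<close> treats as a constant, so that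
  \<open>1 - |z|\<^sup>2 = 1 - c z\<close>.  The whole proof is the classical derivation of a hypergeometric equation
  from a Rodrigues formula.

  The weight \<open>G = z\<^sup>a (1 - c z)\<^sup>b\<close> has logarithmic derivative \<open>a / z - b c / (1 - c z)\<close>; clearing
  denominators, it satisfies a first-order equation whose coefficients are polynomials in \<open>z\<close> of
  degree at most two for \<open>G'\<close> and one for \<open>G\<close>.  Differentiating it \<open>k + 1\<close> times therefore involves only three
  consecutive derivatives of \<open>G\<close>, and gives the second-order equation
  \<open>z (1 - c z) h'' + ((k + 1)(1 - 2 c z) - (a - (a + b) c z)) h' + (k + 1)(a + b - k) c h = 0\<close>
  for \<open>h = \<partial>\<^sup>k G / \<partial>z\<^sup>k\<close>; this is \<open>zernike_weight_iterate_ode\<close>.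

  A Zernike function is locally \<open>E h\<close>, where \<open>h\<close> is the \<open>m\<close>-th derivative of a weight and \<open>E\<close> is, up
  to sign, again a weight.  The logarithmic derivative of \<open>E\<close> is an explicit rational function, so
  \<open>E h\<close> satisfies a second-order equation too, and with \<open>a = n + \<rho>\<close>, \<open>b = \<kappa> + m\<close> and \<open>k = m\<close> the
  poles at \<open>1 - c z = 0\<close> cancel and the stated coefficients appear.
\<close>


section \<open>Calculus of the Wirtinger derivative\<close>

text \<open>
  Unlike \<^const>\<open>wirtinger\<close>, this relation asserts real differentiability, so that the sum, product
  and chain rules hold for it without side conditions.
\<close>
definition has_wirtinger_derivative ::
    "(complex \<Rightarrow> complex) \<Rightarrow> complex \<Rightarrow> complex \<Rightarrow> bool" (infix "has'_wirtinger'_derivative" 50) where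
  "(f has_wirtinger_derivative D) z \<longleftrightarrow>
     (\<exists>D'. (f has_derivative (\<lambda>h. D * h + D' * cnj h)) (at z))"

lemma has_wirtinger_derivative_imp_wirtinger:
  "(f has_wirtinger_derivative D) z \<Longrightarrow> wirtinger f z = D"
  unfolding has_wirtinger_derivative_def by (blast intro: wirtinger_eqI)

lemma has_wirtinger_derivative_imp_differentiable:
  "(f has_wirtinger_derivative D) z \<Longrightarrow> f differentiable (at z)"
  unfolding has_wirtinger_derivative_def differentiable_def by blast

lemma has_wirtinger_derivative_unique:
  "(f has_wirtinger_derivative D) z \<Longrightarrow> (f has_wirtinger_derivative E) z \<Longrightarrow> D = E"
  using has_wirtinger_derivative_imp_wirtinger by blast

lemma has_wirtinger_derivative_transform:
  assumes "(f has_wirtinger_derivative D) z" "open U" "z \<in> U" "\<And>w. w \<in> U \<Longrightarrow> f w = g w"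
  shows "(g has_wirtinger_derivative D) z"
  using assms has_derivative_transform_within_open
  unfolding has_wirtinger_derivative_def by blast

lemma has_wirtinger_derivative_const: "((\<lambda>_. c) has_wirtinger_derivative 0) z"
  unfolding has_wirtinger_derivative_def by (intro exI[of _ 0]) simp

lemma has_wirtinger_derivative_ident: "((\<lambda>w. w) has_wirtinger_derivative 1) z"
  unfolding has_wirtinger_derivative_def by (intro exI[of _ 0]) simp

lemma has_wirtinger_derivative_cnj: "(cnj has_wirtinger_derivative 0) z"
  unfolding has_wirtinger_derivative_def
  by (intro exI[of _ 1]) (simp add: bounded_linear_imp_has_derivative[OF bounded_linear_cnj])

lemma has_wirtinger_derivative_add:
  assumes "(f has_wirtinger_derivative D) z" "(g has_wirtinger_derivative E) z"
  shows "((\<lambda>w. f w + g w) has_wirtinger_derivative D + E) z"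
proof -
  obtain D' E' where "(f has_derivative (\<lambda>h. D * h + D' * cnj h)) (at z)"
    "(g has_derivative (\<lambda>h. E * h + E' * cnj h)) (at z)"
    using assms unfolding has_wirtinger_derivative_def by blast
  from has_derivative_add[OF this] show ?thesis
    unfolding has_wirtinger_derivative_def by (intro exI[of _ "D' + E'"]) (simp add: algebra_simps)
qed

lemma has_wirtinger_derivative_mult:
  assumes "(f has_wirtinger_derivative D) z" "(g has_wirtinger_derivative E) z"
  shows "((\<lambda>w. f w * g w) has_wirtinger_derivative D * g z + f z * E) z"
proof -
  obtain D' E' where "(f has_derivative (\<lambda>h. D * h + D' * cnj h)) (at z)"
    "(g has_derivative (\<lambda>h. E * h + E' * cnj h)) (at z)"
    using assms unfolding has_wirtinger_derivative_def by blast
  from has_derivative_mult[OF this] show ?thesis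
    unfolding has_wirtinger_derivative_def
    by (intro exI[of _ "D' * g z + f z * E'"]) (simp add: algebra_simps)
qed

lemma has_wirtinger_derivative_chain:
  assumes "(f has_wirtinger_derivative D) z" "(g has_field_derivative E) (at (f z))"
  shows "((\<lambda>w. g (f w)) has_wirtinger_derivative E * D) z"
proof -
  obtain D' where f: "(f has_derivative (\<lambda>h. D * h + D' * cnj h)) (at z)"
    using assms unfolding has_wirtinger_derivative_def by blast
  have "(g has_derivative (*) E) (at (f z))"
    using assms(2) by (simp add: has_field_derivative_def)
  from diff_chain_at[OF f this] show ?thesis
    unfolding has_wirtinger_derivative_def
    by (intro exI[of _ "E * D'"]) (simp add: o_def algebra_simps)
qed

lemma has_wirtinger_derivative_diff:
  assumes "(f has_wirtinger_derivative D) z" "(g has_wirtinger_derivative E) z"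
  shows "((\<lambda>w. f w - g w) has_wirtinger_derivative D - E) z"
  using has_wirtinger_derivative_add[OF assms(1)
      has_wirtinger_derivative_mult[OF has_wirtinger_derivative_const[of "-1"] assms(2)]]
  by simp

lemma has_wirtinger_derivative_inverse:
  assumes "(f has_wirtinger_derivative D) z" "f z \<noteq> 0"
  shows "((\<lambda>w. inverse (f w)) has_wirtinger_derivative - (inverse (f z))\<^sup>2 * D) z"
  using has_wirtinger_derivative_chain[OF assms(1) DERIV_inverse[OF assms(2)]]
  by (simp add: power2_eq_square)

lemmas has_wirtinger_derivative_intros =
  has_wirtinger_derivative_const has_wirtinger_derivative_ident has_wirtinger_derivative_cnj
  has_wirtinger_derivative_add has_wirtinger_derivative_diff has_wirtinger_derivative_mult
  has_wirtinger_derivative_inverse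

lemma has_wirtinger_derivative_eq_rhs:
  "(f has_wirtinger_derivative D) z \<Longrightarrow> D = E \<Longrightarrow> (f has_wirtinger_derivative E) z"
  by simp


section \<open>The weight and its iterated derivatives\<close>

definition zernike_weight :: "(complex \<Rightarrow> complex) \<Rightarrow> complex \<Rightarrow> real \<Rightarrow> complex \<Rightarrow> complex" where
  "zernike_weight L a b w = exp (a * L w) * of_real ((1 - (cmod w)\<^sup>2) powr b)"

lemma one_minus_mult_cnj_nonzero:
  assumes "w \<in> ball 0 1"
  shows "1 - w * cnj w \<noteq> 0"
proof -
  have "(cmod w)\<^sup>2 < 1"
    using assms by (auto simp: power_less_one_iff abs_square_less_1)
  moreover have "1 - w * cnj w = of_real (1 - (cmod w)\<^sup>2)"
    by (simp only: of_real_diff of_real_1 complex_norm_square)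
  ultimately show ?thesis
    by (metis less_irrefl of_real_eq_0_iff diff_gt_0_iff_gt)
qed

lemma zernike_weight_has_wirtinger_derivative:
  assumes "log_branch U L" "U \<subseteq> ball 0 1" "w \<in> U"
  shows "(zernike_weight L a b has_wirtinger_derivative
      (a * inverse w - of_real b * cnj w * inverse (1 - w * cnj w)) * zernike_weight L a b w) w"
proof -
  define N where "N = (\<lambda>v. 1 - v * cnj v)"
  have N: "N v = of_real (1 - (cmod v)\<^sup>2)" for v
    by (simp only: N_def of_real_diff of_real_1 complex_norm_square)
  have pos: "1 - (cmod v)\<^sup>2 > 0" if "v \<in> U" for v
    using that assms(2) by (auto simp: power_less_one_iff abs_square_less_1)
  (* On U the real power is exp (b * Ln N), so the chain rule through holomorphic functions applies. *)
  have eq: "exp (a * L v + of_real b * Ln (N v)) = zernike_weight L a b v" if "v \<in> U" for v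
    using pos[OF that]
    by (simp add: zernike_weight_def exp_add powr_def N Ln_of_real exp_of_real
          flip: of_real_mult del: of_real_diff)
  have dL: "(L has_wirtinger_derivative inverse w) w"
    using has_wirtinger_derivative_chain[OF has_wirtinger_derivative_ident
        log_branch_deriv[OF assms(1,3)]] by simp
  have dN: "(N has_wirtinger_derivative - cnj w) w"
    unfolding N_def
    by (rule has_wirtinger_derivative_eq_rhs, (rule has_wirtinger_derivative_intros)+) simp
  have "N w \<notin> \<real>\<^sub>\<le>\<^sub>0"
    using pos[OF assms(3)] unfolding N by (simp del: of_real_diff)
  then have dLn: "((\<lambda>v. Ln (N v)) has_wirtinger_derivative inverse (N w) * - cnj w) w"
    using has_wirtinger_derivative_chain[OF dN has_field_derivative_Ln] by blast
  have "((\<lambda>v. a * L v + of_real b * Ln (N v)) has_wirtinger_derivative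
      a * inverse w - of_real b * cnj w * inverse (N w)) w"
    by (rule has_wirtinger_derivative_eq_rhs,
        (rule has_wirtinger_derivative_intros dL dLn)+) simp
  from has_wirtinger_derivative_chain[OF this DERIV_exp]
  have "((\<lambda>v. exp (a * L v + of_real b * Ln (N v))) has_wirtinger_derivative
      (a * inverse w - of_real b * cnj w * inverse (N w)) * zernike_weight L a b w) w"
    unfolding eq[OF assms(3)] by (simp only: mult.commute)
  moreover have "N w = 1 - w * cnj w"
    by (simp only: N_def)
  ultimately have "((\<lambda>v. exp (a * L v + of_real b * Ln (N v))) has_wirtinger_derivative
      (a * inverse w - of_real b * cnj w * inverse (1 - w * cnj w)) * zernike_weight L a b w) w"
    by simp
  then show ?thesis
    by (rule has_wirtinger_derivative_transform) (use assms eq in \<open>auto simp: log_branch_def\<close>)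
qed

text \<open>
  The iterates stay in \<^const>\<open>power_span\<close>, whose members are differentiable; so the iterated
  \<^const>\<open>wirtinger\<close> really computes successive derivatives of the weight.
\<close>
lemma zernike_weight_iterate_has_wirtinger_derivative:
  assumes "log_branch U L" "U \<subseteq> ball 0 1" "w \<in> U"
  shows "((wirtinger ^^ k) (zernike_weight L a b) has_wirtinger_derivative
      (wirtinger ^^ Suc k) (zernike_weight L a b) w) w"
proof -
  have "zernike_weight L a b \<in> power_span L"
    using power_span_monom[of a L 0 b] by (simp add: zernike_weight_def[abs_def])
  then obtain g where g: "g \<in> power_span L"
    "\<And>v. v \<in> U \<Longrightarrow> (wirtinger ^^ k) (zernike_weight L a b) v = g v"
    using wirtinger_iterate[OF _ assms(1,2), of _ _ 1 k] by fastforce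
  obtain d where "(g has_wirtinger_derivative d) w"
    using power_span_derivative[OF g(1) assms(1,2)] assms(3)
    unfolding has_wirtinger_derivative_def by blast
  then have "((wirtinger ^^ k) (zernike_weight L a b) has_wirtinger_derivative d) w"
    by (rule has_wirtinger_derivative_transform)
       (use assms g(2) in \<open>auto simp: log_branch_def\<close>)
  then show ?thesis
    using has_wirtinger_derivative_imp_wirtinger by fastforce
qed

text \<open>
  For \<open>k = 0\<close> this is the derivative of the first-order equation of the weight, and the equation for
  \<open>k + 1\<close> is the derivative of the one for \<open>k\<close>.  Each equation can be differentiated because it
  holds on the whole open set.
\<close>
lemma zernike_weight_iterate_ode:
  fixes a :: complex and b :: real
  assumes "log_branch U L" "U \<subseteq> ball 0 1" "w \<in> U"
  defines "h \<equiv> \<lambda>k. (wirtinger ^^ k) (zernike_weight L a b)"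
  shows "w * (1 - w * cnj w) * h (Suc (Suc k)) w
    + (of_nat (Suc k) * (1 - 2 * w * cnj w) - (a - (a + of_real b) * w * cnj w)) * h (Suc k) w
    + of_nat (Suc k) * (a + of_real b - of_nat k) * cnj w * h k w = 0"
  using assms(3)
proof (induction k arbitrary: w)
  case (0 w)
  have U: "open U" using assms(1) by (simp add: log_branch_def)
  have dh: "(h k has_wirtinger_derivative h (Suc k) v) v" if "v \<in> U" for k v
    unfolding h_def using zernike_weight_iterate_has_wirtinger_derivative[OF assms(1,2) that] .
  have first_order: "v * (1 - v * cnj v) * h 1 v - (a - (a + of_real b) * v * cnj v) * h 0 v = 0"
    if v: "v \<in> U" for v
  proof -
    have "exp (L v) = v" using v assms(1) by (auto simp: log_branch_def)
    then have "v * inverse v = 1" by (metis exp_not_eq_zero right_inverse)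
    moreover have "(1 - v * cnj v) * inverse (1 - v * cnj v) = 1"
      using one_minus_mult_cnj_nonzero v assms(2) by (intro right_inverse) blast
    moreover have "h 1 v = (a * inverse v - of_real b * cnj v * inverse (1 - v * cnj v)) * h 0 v"
      using has_wirtinger_derivative_imp_wirtinger[OF
          zernike_weight_has_wirtinger_derivative[OF assms(1,2) v, of a b]]
      by (simp add: h_def)
    ultimately show ?thesis by algebra
  qed
  let ?F = "\<lambda>v. v * (1 - v * cnj v) * h 1 v - (a - (a + of_real b) * v * cnj v) * h 0 v"
  have "(?F has_wirtinger_derivative
      w * (1 - w * cnj w) * h (Suc 1) w + (1 - 2 * w * cnj w) * h 1 w
      - ((a - (a + of_real b) * w * cnj w) * h (Suc 0) w - (a + of_real b) * cnj w * h 0 w)) w"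
    by (rule has_wirtinger_derivative_eq_rhs,
        (rule has_wirtinger_derivative_intros dh[OF 0])+) (simp add: algebra_simps)
  moreover have "(?F has_wirtinger_derivative 0) w"
    by (rule has_wirtinger_derivative_transform[OF has_wirtinger_derivative_const[of 0] U 0])
       (use first_order in simp)
  ultimately show ?case
    using has_wirtinger_derivative_unique by (fastforce simp: algebra_simps)
next
  case (Suc k w)
  have U: "open U" using assms(1) by (simp add: log_branch_def)
  have dh: "(h j has_wirtinger_derivative h (Suc j) w) w" for j
    unfolding h_def
    using zernike_weight_iterate_has_wirtinger_derivative[OF assms(1,2) Suc.prems] .
  let ?F = "\<lambda>w. w * (1 - w * cnj w) * h (Suc (Suc k)) w
    + (of_nat (Suc k) * (1 - 2 * w * cnj w) - (a - (a + of_real b) * w * cnj w)) * h (Suc k) w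
    + of_nat (Suc k) * (a + of_real b - of_nat k) * cnj w * h k w"
  let ?D = "w * (1 - w * cnj w) * h (Suc (Suc (Suc k))) w
    + (of_nat (Suc (Suc k)) * (1 - 2 * w * cnj w) - (a - (a + of_real b) * w * cnj w))
      * h (Suc (Suc k)) w
    + of_nat (Suc (Suc k)) * (a + of_real b - of_nat (Suc k)) * cnj w * h (Suc k) w"
  have "(?F has_wirtinger_derivative ?D) w"
    by (rule has_wirtinger_derivative_eq_rhs,
        (rule has_wirtinger_derivative_intros dh)+) (simp add: algebra_simps)
  moreover have "(?F has_wirtinger_derivative 0) w"
    by (rule has_wirtinger_derivative_transform[OF has_wirtinger_derivative_const[of 0] U Suc.prems])
       (use Suc.IH in simp)
  ultimately show ?case
    using has_wirtinger_derivative_unique by blast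
qed


section \<open>The differential equation\<close>

text \<open>
  Passing from \<open>h\<close> to \<open>f = E h\<close>.  The letters stand for values at a point: \<open>p\<close> and \<open>q\<close> for the
  inverses of \<open>z\<close> and \<open>1 - c z\<close>, \<open>v\<close> for the logarithmic derivative of \<open>E\<close>, and \<open>h0\<close>, \<open>h1\<close>, \<open>h2\<close> for
  \<open>h\<close> and its first two derivatives.  Since \<open>E' = v E\<close> and \<open>v' = r p\<^sup>2 + k c\<^sup>2 q\<^sup>2\<close>, the three
  multiples of \<open>E\<close> on the left-hand side are \<open>f''\<close>, \<open>f'\<close> and \<open>f\<close>.
\<close>
lemma zernike_ode_algebra:
  fixes z c p q h0 h1 h2 E n m r k v :: complex
  assumes "z * p = 1" "(1 - z * c) * q = 1" and "v = k * c * q - r * p"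
    and ode: "z * (1 - z * c) * h2
      + ((m + 1) * (1 - 2 * z * c) - ((n + r) - (n + r + (k + m)) * z * c)) * h1
      + (m + 1) * (n + r + (k + m) - m) * c * h0 = 0"
  shows "z\<^sup>2 * (1 - z * c) * (E * (h2 + 2 * v * h1 + (v\<^sup>2 + r * p\<^sup>2 + k * c\<^sup>2 * q\<^sup>2) * h0))
    + ((m + r - n + 1) - (k + (m + r) - n + 2) * (z * c)) * z * (E * (h1 + v * h0))
    + (n * (k + (m + r) + 1) * (z * c)) * (E * h0)
    = (r * (n - m)) * (E * h0)"
  using assms by algebra

theorem theorem3p11:
  fixes \<rho> \<kappa> :: real and m :: nat and n :: int
  fixes m\<^sub>\<rho> :: real and f :: "complex \<Rightarrow> complex"
  assumes "\<rho> > -1" and "\<kappa> > -1" and "of_int n + \<rho> \<ge> 0"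
  defines "m\<^sub>\<rho> \<equiv> real m + \<rho>"
  defines "f \<equiv> zernike \<kappa> \<rho> m n"
  shows "\<forall>z\<in>punctured_disc.
    f differentiable (at z) \<and> wirtinger f differentiable (at z) \<and>
    z\<^sup>2 * of_real (1 - (cmod z)\<^sup>2) * wirtinger (wirtinger f) z
    + of_real ((m\<^sub>\<rho> - of_int n + 1) - (\<kappa> + m\<^sub>\<rho> - of_int n + 2) * (cmod z)\<^sup>2) * z * wirtinger f z
    + of_real (of_int n * (\<kappa> + m\<^sub>\<rho> + 1) * (cmod z)\<^sup>2) * f z
    = of_real (\<rho> * (of_int n - real m)) * f z"
proof
  fix z assume z: "z \<in> punctured_disc"
  then have z0: "z \<noteq> 0" and zb: "z \<in> ball 0 1" by (auto simp: punctured_disc_def)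
  define L where "L = (\<lambda>w. Ln z + Ln (w / z))"
  define U where "U = {w. Re (w / z) > 0} \<inter> ball 0 1"
  have L: "log_branch U L"
    using log_branch_local[OF z0] unfolding U_def L_def
    by (auto simp: log_branch_def intro: holomorphic_on_subset)
  have U: "open U" "U \<subseteq> ball 0 1" "z \<in> U"
    using L zb z0 by (auto simp: log_branch_def U_def)
  have nz: "w \<noteq> 0" "1 - w * cnj w \<noteq> 0" if "w \<in> U" for w
    using L that U(2) one_minus_mult_cnj_nonzero[of w]
    by (auto simp: log_branch_def)
  define a where "a = complex_of_real (of_int n + \<rho>)"
  define b where "b = \<kappa> + real m"
  define h where "h = (\<lambda>k. (wirtinger ^^ k) (zernike_weight L a b))"
  define E where "E = (\<lambda>w. (-1) ^ m * zernike_weight L (- of_real \<rho>) (- \<kappa>) w)"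
  define v where "v = (\<lambda>w. of_real \<kappa> * cnj w * inverse (1 - w * cnj w) - of_real \<rho> * inverse w)"
  have f_eq: "f w = E w * h m w" if "w \<in> U" for w
  proof -
    have "w \<in> punctured_disc"
      using that nz U(2) by (auto simp: punctured_disc_def)
    from zernike_eq_zernike_branch[OF this L that, of \<kappa> \<rho> m n] show ?thesis
      by (simp add: f_def zernike_branch_def E_def h_def a_def b_def zernike_weight_def[abs_def])
  qed
  have dh: "(h k has_wirtinger_derivative h (Suc k) w) w" if "w \<in> U" for k w
    unfolding h_def using zernike_weight_iterate_has_wirtinger_derivative[OF L U(2) that] .
  have dE: "(E has_wirtinger_derivative v w * E w) w" if "w \<in> U" for w
    unfolding E_def
    by (rule has_wirtinger_derivative_eq_rhs,
        (rule has_wirtinger_derivative_intros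
          zernike_weight_has_wirtinger_derivative[OF L U(2) that])+)
       (simp add: v_def algebra_simps)
  have dv: "(v has_wirtinger_derivative of_real \<rho> * (inverse w)\<^sup>2
      + of_real \<kappa> * (cnj w)\<^sup>2 * (inverse (1 - w * cnj w))\<^sup>2) w" if "w \<in> U" for w
    unfolding v_def
    by (rule has_wirtinger_derivative_eq_rhs,
        (rule has_wirtinger_derivative_intros nz[OF that])+)
       (simp add: algebra_simps power2_eq_square)
  have df: "(f has_wirtinger_derivative E w * (h (Suc m) w + v w * h m w)) w" if "w \<in> U" for w
  proof (rule has_wirtinger_derivative_transform[OF _ U(1) that])
    show "((\<lambda>w. E w * h m w) has_wirtinger_derivative E w * (h (Suc m) w + v w * h m w)) w"
      by (rule has_wirtinger_derivative_eq_rhs,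
          (rule has_wirtinger_derivative_intros dE[OF that] dh[OF that])+)
         (simp add: algebra_simps)
  qed (simp add: f_eq)
  have wf: "wirtinger f w = E w * (h (Suc m) w + v w * h m w)" if "w \<in> U" for w
    using has_wirtinger_derivative_imp_wirtinger[OF df[OF that]] .
  have ddf: "(wirtinger f has_wirtinger_derivative E z * (h (Suc (Suc m)) z + 2 * v z * h (Suc m) z
      + ((v z)\<^sup>2 + of_real \<rho> * (inverse z)\<^sup>2
         + of_real \<kappa> * (cnj z)\<^sup>2 * (inverse (1 - z * cnj z))\<^sup>2) * h m z)) z"
    (is "(_ has_wirtinger_derivative ?D) z")
  proof (rule has_wirtinger_derivative_transform[OF _ U(1,3)])
    show "((\<lambda>w. E w * (h (Suc m) w + v w * h m w)) has_wirtinger_derivative ?D) z"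
      by (rule has_wirtinger_derivative_eq_rhs,
          (rule has_wirtinger_derivative_intros dE[OF U(3)] dh[OF U(3)] dv[OF U(3)])+)
         (simp add: algebra_simps power2_eq_square)
  qed (simp add: wf)
  have ode: "z * (1 - z * cnj z) * h (Suc (Suc m)) z
      + ((of_nat m + 1) * (1 - 2 * z * cnj z)
         - ((of_int n + of_real \<rho>) - (of_int n + of_real \<rho> + (of_real \<kappa> + of_nat m)) * z * cnj z))
        * h (Suc m) z
      + (of_nat m + 1) * (of_int n + of_real \<rho> + (of_real \<kappa> + of_nat m) - of_nat m) * cnj z * h m z
      = 0"
    using zernike_weight_iterate_ode[OF L U(2,3), where a = a and b = b and k = m]
    by (simp add: h_def a_def b_def add.commute[of 1])
  have norm: "complex_of_real ((cmod z)\<^sup>2) = z * cnj z"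
    by (rule complex_norm_square)
  show "f differentiable (at z) \<and> wirtinger f differentiable (at z) \<and>
    z\<^sup>2 * of_real (1 - (cmod z)\<^sup>2) * wirtinger (wirtinger f) z
    + of_real ((m\<^sub>\<rho> - of_int n + 1) - (\<kappa> + m\<^sub>\<rho> - of_int n + 2) * (cmod z)\<^sup>2) * z * wirtinger f z
    + of_real (of_int n * (\<kappa> + m\<^sub>\<rho> + 1) * (cmod z)\<^sup>2) * f z
    = of_real (\<rho> * (of_int n - real m)) * f z"
  proof (intro conjI)
    show "f differentiable (at z)"
      using has_wirtinger_derivative_imp_differentiable[OF df[OF U(3)]] .
    show "wirtinger f differentiable (at z)"
      using has_wirtinger_derivative_imp_differentiable[OF ddf] .
    show "z\<^sup>2 * of_real (1 - (cmod z)\<^sup>2) * wirtinger (wirtinger f) z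
      + of_real ((m\<^sub>\<rho> - of_int n + 1) - (\<kappa> + m\<^sub>\<rho> - of_int n + 2) * (cmod z)\<^sup>2) * z * wirtinger f z
      + of_real (of_int n * (\<kappa> + m\<^sub>\<rho> + 1) * (cmod z)\<^sup>2) * f z
      = of_real (\<rho> * (of_int n - real m)) * f z"
      unfolding has_wirtinger_derivative_imp_wirtinger[OF ddf] wf[OF U(3)] f_eq[OF U(3)] m\<^sub>\<rho>_def
        of_real_diff of_real_add of_real_mult norm of_real_of_int_eq of_real_of_nat_eq
        of_real_1 of_real_numeral
      by (rule zernike_ode_algebra[OF _ _ _ ode])
         (use nz[OF U(3)] in \<open>simp_all add: v_def\<close>)
  qed
qed

end
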